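(* Fix a total order on the set $\mathbb M$ of marks. For every marked forest $(T,\mathsf m)$, $$D_{(T,\mathsf m)}(\mathbf z)=M'_{(T,\mathsf m)}(z_{w,d}=D_{\bullet_{w,d}}).$$
   Context: A mark is a pair $(w,d)$ of integers with $w\ge1,d\ge0,w\ge d+1$; $\mathbb M$ is the set of marks, with dot-sum $(w,d)\dotplus(w',d')=(w+w',d+d'+1)$. A marked forest $(T,\mathsf m)$ is a forest with a mark on each vertex. Contracting an edge $e=uv$ merges $u,v$ into one vertex (inheriting the other incident edges) with mark $\mathsf m(u)\dotplus\mathsf m(v)$; for disjoint edge sets $A_1,A_2$, $(T/A_1\setminus A_2,\mathsf m/A_1)$ contracts the edges of $A_1$ and deletes those of $A_2$. The $M$-polynomial $M_{(T,\mathsf m)}(\mathbf z)=\sum_{A\subseteq E(T)}\prod_C z_{\mathsf m(C)}$ (product over connected components $C$ of $(V(T),A)$, $\mathsf m(C)$ the dot-sum of marks of the vertices of $C$), in commuting indeterminates $z_{w,d}$. With $D_{\bullet_{w,d}}=\sum_{i=0}^d(-1)^i\binom di z_{w-i,0}z_{1,0}^i$, $D_{(T,\mathsf m)}(\mathbf z)$ is $M_{(T,\mathsf m)}$ with each $z_{w,d}$ replaced by $D_{\bullet_{w,d}}$. A vertex is absorbable if it has degree $1$ and mark $(1,0)$; absorbing an edge $uv$ with $v$ absorbable and $\mathsf m(u)=(w,d)$ contracts it and gives the merged vertex mark $(w+1,d)$; the core of $(T,\mathsf m)$ is obtained by absorbing edges incident with absorbable vertices until none remain. The polynomial $M'_{(T,\mathsf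 m)}(\mathbf z)$ is defined recursively: (1) if $T$ is a single vertex with mark $(w,d)$, $M'=z_{w,d}$; (2) if $T$ has connected components $(T_1,\mathsf m_1),\dots,(T_k,\mathsf m_k)$ with $k>1$, $M'_{(T,\mathsf m)}=\prod_i M'_{(T_i,\mathsf m_i)}$; (3) if $T$ is connected and has absorbable vertices, $M'_{(T,\mathsf m)}=M'$ of its core; (4) if $T$ is connected, has at least one edge and no absorbable vertices, let $A$ be the set of pendant edges (edges incident with a leaf); if $T$ is a star whose center has mark $(1,0)$, let $e$ be the pendant edge incident with the leaf of largest mark in the fixed order (ties broken arbitrarily) and $A'=A\setminus\{e\}$; otherwise $A'=A$; then $M'_{(T,\mathsf m)}=\sum_{A_1\sqcup A_2=A'}M'_{(T/A_1\setminus A_2,\mathsf m/A_1)}$, the sum over ordered pairs of disjoint sets with union $A'$. *)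

theory Defs
  imports Main "HOL-Library.Poly_Mapping"
begin

type_synonym mark = "int \<times> int"

definition marks :: "mark set" where
  "marks = {(w, d). w \<ge> 1 \<and> d \<ge> 0 \<and> w \<ge> d + 1}"

definition dotplus :: "mark \<Rightarrow> mark \<Rightarrow> mark" where
  "dotplus a b = (fst a + fst b, snd a + snd b + 1)"

text \<open>On all pairs of integers the dot-sum has the neutral element \<open>(0, -1)\<close>, which is not a mark.
  It serves only as the value of the empty dot-sum, so that the library's iteration of a
  commutative monoid over a finite set applies.\<close>

global_interpretation dot_sum: comm_monoid_set dotplus "(0, -1)"
  defines dot_sum = dot_sum.F
  by unfold_locales (auto simp: dotplus_def)


section \<open>Polynomials in the indeterminates \<open>z\<^sub>w\<^sub>,\<^sub>d\<close>\<close>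

type_synonym zpoly = "(mark \<Rightarrow>\<^sub>0 nat) \<Rightarrow>\<^sub>0 int"

definition z :: "mark \<Rightarrow> zpoly" where
  "z a = Poly_Mapping.single (Poly_Mapping.single a 1) 1"

definition zsubst :: "(mark \<Rightarrow> zpoly) \<Rightarrow> zpoly \<Rightarrow> zpoly" where
  "zsubst f p = (\<Sum>t\<in>Poly_Mapping.keys p. of_int (Poly_Mapping.lookup p t) *
     (\<Prod>a\<in>Poly_Mapping.keys t. f a ^ Poly_Mapping.lookup t a))"


section \<open>Marked forests\<close>

text \<open>Vertex set, edge set (an edge is the two-element set of its ends) and marking; the marking
  is irrelevant outside the vertex set.\<close>

type_synonym 'a mgraph = "'a set \<times> 'a set set \<times> ('a \<Rightarrow> mark)"

definition is_cycle :: "'a set set \<Rightarrow> 'a list \<Rightarrow> bool" where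
  "is_cycle E vs \<longleftrightarrow> length vs \<ge> 3 \<and> distinct vs \<and>
     (\<forall>i<length vs. {vs ! i, vs ! (Suc i mod length vs)} \<in> E)"

definition forest :: "'a set \<Rightarrow> 'a set set \<Rightarrow> bool" where
  "forest V E \<longleftrightarrow> finite V \<and> V \<noteq> {} \<and> (\<forall>e\<in>E. e \<subseteq> V \<and> card e = 2) \<and> \<not> (\<exists>vs. is_cycle E vs)"

fun marked_forest :: "'a mgraph \<Rightarrow> bool" where
  "marked_forest (V, E, m) \<longleftrightarrow> forest V E \<and> m ` V \<subseteq> marks"

definition reach :: "'a set \<Rightarrow> 'a set set \<Rightarrow> ('a \<times> 'a) set" where
  "reach V A = {(u, v). u \<in> V \<and> v \<in> V \<and> (u, v) \<in> {(x, y). {x, y} \<in> A}\<^sup>*}"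

definition components :: "'a set \<Rightarrow> 'a set set \<Rightarrow> 'a set set" where
  "components V A = V // reach V A"

definition degree :: "'a set set \<Rightarrow> 'a \<Rightarrow> nat" where
  "degree E v = card {e \<in> E. v \<in> e}"


section \<open>The polynomials \<open>M\<close> and \<open>D\<close>\<close>

fun M_poly :: "'a mgraph \<Rightarrow> zpoly" where
  "M_poly (V, E, m) = (\<Sum>A\<in>Pow E. \<Prod>C\<in>components V A. z (dot_sum m C))"

fun D_bullet :: "mark \<Rightarrow> zpoly" where
  "D_bullet (w, d) =
     (\<Sum>i\<le>nat d. (-1) ^ i * of_nat (nat d choose i) * z (w - int i, 0) * z (1, 0) ^ i)"

definition D_poly :: "'a mgraph \<Rightarrow> zpoly" where
  "D_poly T = zsubst D_bullet (M_poly T)"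


section \<open>Contraction and absorption\<close>

text \<open>A vertex of the contracted forest is a component of \<open>(V, A\<^sub>1)\<close>; to remain in the same vertex
  type, it is named by a chosen element of that component.\<close>

definition rep :: "'a set \<Rightarrow> 'a set set \<Rightarrow> 'a \<Rightarrow> 'a" where
  "rep V A v = (SOME u. u \<in> reach V A `` {v})"

fun contract_delete :: "'a mgraph \<Rightarrow> 'a set set \<Rightarrow> 'a set set \<Rightarrow> 'a mgraph" where
  "contract_delete (V, E, m) A\<^sub>1 A\<^sub>2 =
     (rep V A\<^sub>1 ` V, (\<lambda>e. rep V A\<^sub>1 ` e) ` (E - A\<^sub>1 - A\<^sub>2), \<lambda>v. dot_sum m (reach V A\<^sub>1 `` {v}))"

fun absorbable :: "'a mgraph \<Rightarrow> 'a \<Rightarrow> bool" where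
  "absorbable (V, E, m) v \<longleftrightarrow> v \<in> V \<and> degree E v = 1 \<and> m v = (1, 0)"

text \<open>The vertex merged from \<open>u\<close> and the absorbable vertex \<open>v\<close> keeps the name \<open>u\<close>.\<close>

inductive absorb :: "'a mgraph \<Rightarrow> 'a mgraph \<Rightarrow> bool" where
  "absorbable (V, E, m) v \<Longrightarrow> {u, v} \<in> E \<Longrightarrow> m u = (w, d) \<Longrightarrow>
   absorb (V, E, m) (V - {v}, E - {{u, v}}, m(u := (w + 1, d)))"

definition is_core :: "'a mgraph \<Rightarrow> 'a mgraph \<Rightarrow> bool" where
  "is_core T T' \<longleftrightarrow> absorb\<^sup>*\<^sup>* T T' \<and> \<not> (\<exists>v. absorbable T' v)"


section \<open>The polynomial \<open>M'\<close>\<close>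

definition pendant_edges :: "'a set set \<Rightarrow> 'a set set" where
  "pendant_edges E = {e \<in> E. \<exists>v\<in>e. degree E v = 1}"

definition is_star :: "'a set \<Rightarrow> 'a set set \<Rightarrow> 'a \<Rightarrow> bool" where
  "is_star V E c \<longleftrightarrow> c \<in> V \<and> E = (\<lambda>v. {c, v}) ` (V - {c})"

definition largest_leaf :: "mark rel \<Rightarrow> 'a mgraph \<Rightarrow> 'a \<Rightarrow> bool" where
  "largest_leaf r T l \<longleftrightarrow> (case T of (V, E, m) \<Rightarrow>
     l \<in> V \<and> degree E l = 1 \<and> (\<forall>l'\<in>V. degree E l' = 1 \<longrightarrow> (m l', m l) \<in> r))"

text \<open>\<open>A'\<close> is an admissible set of edges to expand along, for some way of breaking ties.\<close>

definition expansion_edges :: "mark rel \<Rightarrow> 'a mgraph \<Rightarrow> 'a set set \<Rightarrow> bool" where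
  "expansion_edges r T A' \<longleftrightarrow> (case T of (V, E, m) \<Rightarrow>
     if \<exists>c. is_star V E c \<and> m c = (1, 0)
     then \<exists>l e. largest_leaf r T l \<and> e \<in> pendant_edges E \<and> l \<in> e \<and> A' = pendant_edges E - {e}
     else A' = pendant_edges E)"

text \<open>\<open>M' r T p\<close>: the recursion yields \<open>p\<close> for some choice of the order of absorptions and of the
  leaves of largest mark in case of ties (these choices may be made anew at every step).\<close>

inductive M' :: "mark rel \<Rightarrow> 'a mgraph \<Rightarrow> zpoly \<Rightarrow> bool" for r :: "mark rel" where
  vertex: "M' r ({v}, {}, m) (z (m v))"
| disconnected: "M' r (V, E, m) (\<Prod>C\<in>components V E. p C)"
    if "card (components V E) > 1"
       "\<forall>C\<in>components V E. M' r (C, {e \<in> E. e \<subseteq> C}, m) (p C)"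
| absorb: "M' r (V, E, m) p"
    if "card (components V E) = 1" "\<exists>v. absorbable (V, E, m) v"
       "is_core (V, E, m) T'" "M' r T' p"
| expand: "M' r (V, E, m) (\<Sum>A\<^sub>1\<in>Pow A'. p A\<^sub>1)"
    if "card (components V E) = 1" "E \<noteq> {}" "\<not> (\<exists>v. absorbable (V, E, m) v)"
       "expansion_edges r (V, E, m) A'"
       "\<forall>A\<^sub>1\<in>Pow A'. M' r (contract_delete (V, E, m) A\<^sub>1 (A' - A\<^sub>1)) (p A\<^sub>1)"

end

theory Submission
  imports Defs "HOL-Library.FuncSet" "HOL-Library.Disjoint_Sets"
begin

text \<open>Every rule of the recursion for \<open>M'\<close> preserves \<open>D\<close>. For components and for the expansion along a
  set of edges this already holds for \<open>M\<close>, by splitting the sum over edge sets; in the expansion,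
  acyclicity is what keeps distinct edges distinct after contraction. For an absorption it
  follows from \<open>D(w + 1, d) = D(w + 1, d + 1) + D(w, d) D(1, 0)\<close>, which is Pascal's rule: the
  edge at the absorbable vertex is either contracted or deleted. So the order on
  the marks only serves to make the recursion run, and it terminates because the number of vertices
  plus the number of edges drops.

  Acyclicity enters only in the form that every edge is a bridge.\<close>

section \<open>Substitution\<close>

text \<open>A cycle is a list of distinct vertices, which is awkward to follow through the quotient
  map of a contraction. Being a bridge is a statement about reachability alone, and walks in the
  quotient lift to walks in the original graph. This one lifting argument shows both that
  contraction creates no detour around an edge and that it identifies no two remaining edges.

  Absorption changes \<open>M\<close>, but its effect on \<open>D\<close> can be checked for each
  fixed set of the other edges separately: if the component of \<open>u\<close> has dot-sum
  \<open>(W, d')\<close>, absorption turns its weight into \<open>D(W + 1, d')\<close>, and the two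
  terms of Pascal's rule are the contributions with the pendant edge present and absent. The rule
  requires \<open>d' \<ge> 0\<close>, so membership in \<open>marks\<close> belongs to the invariant
  of the recursion.

  \<open>M'\<close> is a relation that leaves choices open. All its values agree after substitution
  because each rule preserves \<open>D\<close> whatever is chosen; that it has a value at all is a
  separate termination argument.\<close>

definition monomial_value :: "(mark \<Rightarrow> zpoly) \<Rightarrow> (mark \<Rightarrow>\<^sub>0 nat) \<Rightarrow> zpoly" where
  "monomial_value f t = (\<Prod>a\<in>Poly_Mapping.keys t. f a ^ Poly_Mapping.lookup t a)"

text \<open>Exponents vanish off the keys, so two monomials can be evaluated over one common index
  set and multiplied factor by factor.\<close>

lemma monomial_value_superset:
  assumes "finite S" "Poly_Mapping.keys t \<subseteq> S"
  shows "monomial_value f t = (\<Prod>a\<in>S. f a ^ Poly_Mapping.lookup t a)"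
  unfolding monomial_value_def
  by (rule prod.mono_neutral_left) (use assms in \<open>auto simp: in_keys_iff\<close>)

lemma monomial_value_add: "monomial_value f (s + t) = monomial_value f s * monomial_value f t"
proof -
  let ?S = "Poly_Mapping.keys s \<union> Poly_Mapping.keys t"
  have "monomial_value f (s + t) = (\<Prod>a\<in>?S. f a ^ Poly_Mapping.lookup (s + t) a)"
    by (rule monomial_value_superset) (auto simp: Poly_Mapping.keys_add)
  also have "\<dots> = (\<Prod>a\<in>?S. f a ^ Poly_Mapping.lookup s a) * (\<Prod>a\<in>?S. f a ^ Poly_Mapping.lookup t a)"
    by (simp add: lookup_add power_add prod.distrib)
  also have "\<dots> = monomial_value f s * monomial_value f t"
    by (simp add: monomial_value_superset[of ?S])
  finally show ?thesis .
qed

text \<open>Coefficients may cancel in a sum, so the keys of \<open>p + q\<close> can be smaller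
  than the union of the keys; a larger index set absorbs this.\<close>

lemma zsubst_superset:
  assumes "finite S" "Poly_Mapping.keys p \<subseteq> S"
  shows "zsubst f p = (\<Sum>t\<in>S. of_int (Poly_Mapping.lookup p t) * monomial_value f t)"
  unfolding zsubst_def monomial_value_def[symmetric]
  by (rule sum.mono_neutral_left) (use assms in \<open>auto simp: in_keys_iff\<close>)

lemma zsubst_0 [simp]: "zsubst f 0 = 0"
  by (simp add: zsubst_def)

lemma zsubst_add: "zsubst f (p + q) = zsubst f p + zsubst f q"
proof -
  let ?S = "Poly_Mapping.keys p \<union> Poly_Mapping.keys q"
  have "zsubst f (p + q) = (\<Sum>t\<in>?S. of_int (Poly_Mapping.lookup (p + q) t) * monomial_value f t)"
    by (rule zsubst_superset) (auto simp: Poly_Mapping.keys_add)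
  also have "\<dots> = zsubst f p + zsubst f q"
    by (simp add: lookup_add ring_distribs sum.distrib zsubst_superset[of ?S])
  finally show ?thesis .
qed

lemma zsubst_sum: "zsubst f (sum p S) = (\<Sum>x\<in>S. zsubst f (p x))"
  by (induction S rule: infinite_finite_induct) (auto simp: zsubst_add)

lemma zsubst_single: "zsubst f (Poly_Mapping.single t c) = of_int c * monomial_value f t"
  by (subst zsubst_superset[of "{t}"]) (auto split: if_splits)

lemma zpoly_eq_sum_single:
  fixes p :: zpoly
  shows "p = (\<Sum>t\<in>Poly_Mapping.keys p. Poly_Mapping.single t (Poly_Mapping.lookup p t))"
  by (rule poly_mapping_eqI) (auto simp: lookup_sum lookup_single when_def in_keys_iff sum.delta)

text \<open>Both factors are split into single terms, where a product just adds exponents;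
  \<open>monomial_value_add\<close> then settles each pair of terms.\<close>

lemma zsubst_mult: "zsubst f (p * q) = zsubst f p * zsubst f q"
proof -
  let ?g = "\<lambda>p t. Poly_Mapping.single t (Poly_Mapping.lookup (p :: zpoly) t)"
  have "p * q = (\<Sum>s\<in>Poly_Mapping.keys p. ?g p s) * (\<Sum>t\<in>Poly_Mapping.keys q. ?g q t)"
    by (simp flip: zpoly_eq_sum_single)
  also have "\<dots> = (\<Sum>s\<in>Poly_Mapping.keys p. \<Sum>t\<in>Poly_Mapping.keys q. ?g p s * ?g q t)"
    by (rule sum_product)
  finally have "zsubst f (p * q) =
      (\<Sum>s\<in>Poly_Mapping.keys p. \<Sum>t\<in>Poly_Mapping.keys q. zsubst f (?g p s * ?g q t))"
    by (simp add: zsubst_sum)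
  also have "\<dots> = (\<Sum>s\<in>Poly_Mapping.keys p. \<Sum>t\<in>Poly_Mapping.keys q.
      (of_int (Poly_Mapping.lookup p s) * monomial_value f s) *
      (of_int (Poly_Mapping.lookup q t) * monomial_value f t))"
    by (simp add: mult_single zsubst_single monomial_value_add mult_ac)
  also have "\<dots> = zsubst f p * zsubst f q"
    by (simp add: zsubst_def sum_product flip: monomial_value_def)
  finally show ?thesis .
qed

lemma zsubst_1 [simp]: "zsubst f 1 = 1"
  using zsubst_single[of f 0 1] by (simp add: monomial_value_def)

lemma zsubst_prod: "zsubst f (prod p S) = (\<Prod>x\<in>S. zsubst f (p x))"
  by (induction S rule: infinite_finite_induct) (auto simp: zsubst_mult)

lemma zsubst_z [simp]: "zsubst f (z a) = f a"
  by (simp add: z_def zsubst_single monomial_value_def)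

section \<open>The Pascal identity behind absorption\<close>

lemma D_bullet_1_0: "D_bullet (1, 0) = z (1, 0)"
  by simp

lemma D_bullet_absorb:
  assumes "d \<ge> 0"
  shows "D_bullet (w + 1, d) = D_bullet (w + 1, d + 1) + D_bullet (w, d) * D_bullet (1, 0)"
proof -
  define n where "n = nat d"
  have n: "nat d = n" "nat (d + 1) = Suc n"
    using assms by (auto simp: n_def)
  let ?x = "z (1, 0)"
  let ?t = "\<lambda>k i. (-1) ^ i * of_nat (k choose i) * z (w + 1 - int i, 0) * ?x ^ i"
  have "D_bullet (w + 1, d + 1) = (\<Sum>i\<le>Suc n. ?t (Suc n) i)"
    by (simp add: n)
  also have "\<dots> = ?t (Suc n) 0 + (\<Sum>i\<le>n. ?t (Suc n) (Suc i))"
    by (subst sum.atMost_Suc_shift) simp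
  \<comment> \<open>Pascal's rule splits \<open>Suc n choose Suc i\<close>. In the part with
    \<open>n choose i\<close> the shift of the index gives the minus sign, one factor
    \<open>z (1, 0)\<close>, and \<open>w + 1 - Suc i = w - i\<close>.\<close>
  also have "(\<Sum>i\<le>n. ?t (Suc n) (Suc i)) = (\<Sum>i\<le>n. ?t n (Suc i)) -
      (\<Sum>i\<le>n. (-1) ^ i * of_nat (n choose i) * z (w - int i, 0) * ?x ^ i) * ?x"
    unfolding sum_distrib_right sum_subtractf[symmetric]
    by (rule sum.cong) (auto simp: algebra_simps)
  also have "?t (Suc n) 0 + ((\<Sum>i\<le>n. ?t n (Suc i)) -
      (\<Sum>i\<le>n. (-1) ^ i * of_nat (n choose i) * z (w - int i, 0) * ?x ^ i) * ?x)
    = (?t n 0 + (\<Sum>i\<le>n. ?t n (Suc i))) - D_bullet (w, d) * ?x"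
    by (simp add: n)
  also have "?t n 0 + (\<Sum>i\<le>n. ?t n (Suc i)) = (\<Sum>i\<le>Suc n. ?t n i)"
    by (subst sum.atMost_Suc_shift) simp
  \<comment> \<open>The surplus term with index \<open>Suc n\<close> vanishes, since
    \<open>n choose Suc n = 0\<close>.\<close>
  also have "\<dots> = D_bullet (w + 1, d)"
    by (simp add: n binomial_eq_0)
  finally show ?thesis
    by (simp add: D_bullet_1_0)
qed

declare D_bullet.simps [simp del]

section \<open>Connectivity\<close>

definition adj :: "'a set set \<Rightarrow> 'a rel" where
  "adj A = {(x, y). {x, y} \<in> A}"

text \<open>Connectivity without reference to a vertex set; it agrees with \<open>reach\<close> as
  soon as all edges lie inside the vertex set, see \<open>reach_Image\<close>.\<close>

definition cls :: "'a set set \<Rightarrow> 'a \<Rightarrow> 'a set" where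
  "cls A x = (adj A)\<^sup>* `` {x}"

lemma adj_mono: "A \<subseteq> B \<Longrightarrow> (adj A)\<^sup>* \<subseteq> (adj B)\<^sup>*"
  by (rule rtrancl_mono) (auto simp: adj_def)

lemma sym_adj_rtrancl: "(x, y) \<in> (adj A)\<^sup>* \<Longrightarrow> (y, x) \<in> (adj A)\<^sup>*"
  by (rule symD[OF sym_rtrancl]) (auto simp: sym_def adj_def insert_commute)

lemma cls_self [simp]: "x \<in> cls A x"
  by (simp add: cls_def)

lemma cls_not_empty [simp]: "cls A x \<noteq> {}"
  by (auto simp: cls_def)

lemma cls_eq_iff: "cls A x = cls A y \<longleftrightarrow> (x, y) \<in> (adj A)\<^sup>*"
  unfolding cls_def by (auto intro: rtrancl_trans) (meson sym_adj_rtrancl rtrancl_trans)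

lemma mem_cls_iff: "y \<in> cls A x \<longleftrightarrow> cls A y = cls A x"
  unfolding cls_eq_iff by (auto simp: cls_def intro: sym_adj_rtrancl)

text \<open>A class is the smallest set that contains its base point and is closed under the edges
  meeting it. This is the usual way to bound a component from above.\<close>

lemma cls_subset:
  assumes "x \<in> C" "\<And>e. e \<in> A \<Longrightarrow> e \<inter> C \<noteq> {} \<Longrightarrow> e \<subseteq> C"
  shows "cls A x \<subseteq> C"
proof
  fix y assume "y \<in> cls A x"
  then have "(x, y) \<in> (adj A)\<^sup>*"
    by (simp add: cls_def)
  then show "y \<in> C"
    by induction (use assms in \<open>auto simp: adj_def\<close>)
qed

lemma reach_Image:
  assumes "A \<subseteq> Pow V" "x \<in> V"
  shows "reach V A `` {x} = cls A x"
proof -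
  have "cls A x \<subseteq> V"
    by (rule cls_subset) (use assms in auto)
  then show ?thesis
    using assms by (auto simp: reach_def cls_def adj_def)
qed

lemma components_eq: "A \<subseteq> Pow V \<Longrightarrow> components V A = cls A ` V"
  by (auto simp: components_def quotient_def reach_Image)

lemma cls_no_edge:
  assumes "\<And>e. e \<in> A \<Longrightarrow> x \<notin> e"
  shows "cls A x = {x}"
  using cls_subset[of x "{x}" A] assms by fastforce

lemma cls_empty [simp]: "cls {} x = {x}"
  by (rule cls_no_edge) simp

lemma cls_cong:
  assumes "x \<in> C" "\<And>e. e \<in> A \<Longrightarrow> e \<inter> C \<noteq> {} \<Longrightarrow> e \<subseteq> C" "\<And>e. e \<subseteq> C \<Longrightarrow> e \<in> A \<longleftrightarrow> e \<in> B"
    "\<And>e. e \<in> B \<Longrightarrow> e \<inter> C \<noteq> {} \<Longrightarrow> e \<subseteq> C"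
  shows "cls A x = cls B x"
proof -
  \<comment> \<open>Stated for arbitrary \<open>A\<close> and \<open>B\<close>, so that exchanging
    them yields the reverse inclusion. Membership in \<open>C\<close> is carried along because the
    two edge sets agree only inside \<open>C\<close>.\<close>
  have *: "(x, y) \<in> (adj B)\<^sup>* \<and> y \<in> C" if "(x, y) \<in> (adj A)\<^sup>*"
    "\<And>e. e \<in> A \<Longrightarrow> e \<inter> C \<noteq> {} \<Longrightarrow> e \<subseteq> C" "\<And>e. e \<subseteq> C \<Longrightarrow> e \<in> A \<longleftrightarrow> e \<in> B" for A B y
    using that(1)
  proof induction
    case (step y w)
    then have "{y, w} \<in> A" "y \<in> C" by (auto simp: adj_def)
    with that(2) have "{y, w} \<subseteq> C" by blast
    with that(3) \<open>{y, w} \<in> A\<close> have "(y, w) \<in> adj B" by (auto simp: adj_def)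
    with step.IH \<open>{y, w} \<subseteq> C\<close> show ?case by (auto intro: rtrancl_into_rtrancl)
  qed (use assms in auto)
  show ?thesis
    using *[of _ A B] *[of _ B A] assms(2-4) unfolding cls_def by blast
qed

section \<open>Bridges\<close>

text \<open>A walk is cut short whenever a vertex recurs; distinctness is demanded by
  \<open>is_cycle\<close>.\<close>

lemma rtrancl_imp_distinct_path:
  assumes "(x, y) \<in> R\<^sup>*"
  shows "\<exists>xs. xs \<noteq> [] \<and> hd xs = x \<and> last xs = y \<and> distinct xs \<and> successively (\<lambda>a b. (a, b) \<in> R) xs"
  using assms
proof (induction rule: converse_rtrancl_induct)
  case base
  show ?case by (rule exI[of _ "[y]"]) auto
next
  case (step x w)
  then obtain xs where xs: "xs \<noteq> []" "hd xs = w" "last xs = y" "distinct xs"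
    "successively (\<lambda>a b. (a, b) \<in> R) xs" by blast
  show ?case
  proof (cases "x \<in> set xs")
    case True
    then obtain ys zs where "xs = ys @ x # zs" by (meson split_list)
    with xs show ?thesis
      by (intro exI[of _ "x # zs"]) (auto simp: successively_append_iff)
  next
    case False
    with xs step(1) show ?thesis
      by (intro exI[of _ "x # xs"]) (auto simp: successively_Cons)
  qed
qed

text \<open>The ends of an edge are separated once the edge is removed. Singleton edges are ruled
  out as well, since \<open>x\<close> always reaches itself.\<close>

definition all_bridges :: "'a set set \<Rightarrow> bool" where
  "all_bridges E \<longleftrightarrow> (\<forall>x y. {x, y} \<in> E \<longrightarrow> (x, y) \<notin> (adj (E - {{x, y}}))\<^sup>*)"

lemma forest_imp_all_bridges:
  assumes "forest V E"
  shows "all_bridges E"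
  unfolding all_bridges_def
proof (intro allI impI notI)
  fix x y
  assume xy: "{x, y} \<in> E" and "(x, y) \<in> (adj (E - {{x, y}}))\<^sup>*"
  then obtain xs where xs: "xs \<noteq> []" "hd xs = x" "last xs = y" "distinct xs"
    and path: "successively (\<lambda>a b. (a, b) \<in> adj (E - {{x, y}})) xs"
    using rtrancl_imp_distinct_path by metis
  have "card {x, y} = 2"
    using assms xy by (auto simp: forest_def)
  then have "x \<noteq> y" by auto
  obtain a as where "xs = x # a # as"
    using xs \<open>x \<noteq> y\<close> by (cases xs; cases "tl xs") auto
  \<comment> \<open>A path with only two vertices would be the edge \<open>{x, y}\<close> itself,
    which was removed.\<close>
  moreover have "as \<noteq> []"
    using path xs calculation by (auto simp: adj_def)
  ultimately have len: "length xs \<ge> 3"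
    by (cases as) auto
  have "{xs ! i, xs ! (Suc i mod length xs)} \<in> E" if "i < length xs" for i
  proof (cases "Suc i < length xs")
    case True
    then show ?thesis
      using path by (auto simp: successively_conv_nth adj_def)
  next
    \<comment> \<open>At the last index the cycle wraps around, and the removed edge closes
      it.\<close>
    case False
    with that have "Suc i = length xs" by auto
    then have "xs ! i = y" "xs ! (Suc i mod length xs) = x"
      using xs by (auto simp: last_conv_nth hd_conv_nth simp flip: \<open>Suc i = length xs\<close>)
    then show ?thesis
      using xy by (simp add: insert_commute)
  qed
  with len xs have "is_cycle E xs"
    by (auto simp: is_cycle_def)
  with assms show False
    by (auto simp: forest_def)
qed

lemma all_bridges_mono: "all_bridges E \<Longrightarrow> F \<subseteq> E \<Longrightarrow> all_bridges F"
  unfolding all_bridges_def using adj_mono[of "F - {e}" "E - {e}" for e] by blast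

fun bridge_forest :: "'a mgraph \<Rightarrow> bool" where
  "bridge_forest (V, E, m) \<longleftrightarrow> finite V \<and> V \<noteq> {} \<and> (\<forall>e\<in>E. e \<subseteq> V \<and> card e = 2) \<and>
     all_bridges E \<and> m ` V \<subseteq> marks"

lemma bridge_forest_edge:
  assumes "bridge_forest (V, E, m)" "e \<in> E"
  obtains x y where "e = {x, y}" "x \<noteq> y" "x \<in> V" "y \<in> V"
  using assms by (metis bridge_forest.simps card_2_iff insert_subset)

lemma bridge_forest_edges_subset: "bridge_forest (V, E, m) \<Longrightarrow> E \<subseteq> Pow V"
  by auto

lemma marked_forest_imp_bridge_forest: "marked_forest T \<Longrightarrow> bridge_forest T"
  using forest_imp_all_bridges by (cases T) (auto simp: forest_def)

text \<open>\<open>M\<close> with its indeterminates replaced by elements of any commutative ring.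
  The identities for components and contractions are thus proved with no substitution around; the
  weight \<open>D_bullet\<close> gives \<open>D\<close>.\<close>

fun weight_sum :: "(mark \<Rightarrow> 'b::comm_ring_1) \<Rightarrow> 'a mgraph \<Rightarrow> 'b" where
  "weight_sum g (V, E, m) = (\<Sum>A\<in>Pow E. \<Prod>C\<in>components V A. g (dot_sum m C))"

lemma D_poly_eq_weight_sum: "D_poly T = weight_sum D_bullet T"
  by (cases T) (simp add: D_poly_def zsubst_sum zsubst_prod)

lemma dotplus_marks: "a \<in> marks \<Longrightarrow> b \<in> marks \<Longrightarrow> dotplus a b \<in> marks"
  by (auto simp: marks_def dotplus_def)

text \<open>Nonemptiness matters because the empty dot-sum \<open>(0, -1)\<close> is not a
  mark.\<close>

lemma dot_sum_marks:
  assumes "finite C" "C \<noteq> {}" "m ` C \<subseteq> marks"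
  shows "dot_sum m C \<in> marks"
  using assms
  by (induction rule: finite_ne_induct) (auto simp: dotplus_marks dot_sum.insert)

section \<open>Contraction\<close>

context
  fixes V :: "'a set" and A :: "'a set set"
  assumes A: "A \<subseteq> Pow V"
begin

lemma rep_in_cls: "x \<in> V \<Longrightarrow> rep V A x \<in> cls A x"
  unfolding rep_def by (rule someI2[of _ x]) (auto simp: reach_Image[OF A])

lemma cls_subset_V: "x \<in> V \<Longrightarrow> cls A x \<subseteq> V"
  by (rule cls_subset) (use A in auto)

lemma rep_in_V: "x \<in> V \<Longrightarrow> rep V A x \<in> V"
  using rep_in_cls[of x] cls_subset_V[of x] by blast

lemma cls_rep: "x \<in> V \<Longrightarrow> cls A (rep V A x) = cls A x"
  using rep_in_cls[of x] by (simp add: mem_cls_iff)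

text \<open>The choice in \<open>rep\<close> depends only on the class as a set, so vertices of one
  class get literally the same representative.\<close>

lemma rep_eq_iff: "x \<in> V \<Longrightarrow> y \<in> V \<Longrightarrow> rep V A x = rep V A y \<longleftrightarrow> (x, y) \<in> (adj A)\<^sup>*"
  unfolding cls_eq_iff[symmetric]
  using cls_rep[of x] cls_rep[of y] reach_Image[OF A, of x] reach_Image[OF A, of y]
  by (metis rep_def)

context
  fixes B :: "'a set set"
  assumes B: "\<And>e. e \<in> B \<Longrightarrow> e \<subseteq> V \<and> card e = 2"
begin

text \<open>Walks lift from the quotient: each quotient edge comes from an edge in \<open>B\<close>,
  and between two preimages of one quotient vertex the walk moves along \<open>A\<close>. The
  endpoint \<open>y\<close> is arbitrary in the induction so that the preimage can be changed at
  every step.\<close>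

lemma contract_connected_imp:
  assumes "(a, b) \<in> (adj ((`) (rep V A) ` B))\<^sup>*" "x \<in> V" "rep V A x = a" "y \<in> V" "rep V A y = b"
  shows "(x, y) \<in> (adj (A \<union> B))\<^sup>*"
  using assms
proof (induction arbitrary: y rule: rtrancl_induct)
  case base
  then show ?case
    using rep_eq_iff[of x y] adj_mono[of A "A \<union> B"] by auto
next
  case (step b c)
  then obtain f where f: "f \<in> B" "{b, c} = rep V A ` f"
    by (auto simp: adj_def)
  obtain p q where "f = {p, q}"
    using B[OF f(1)] by (auto simp: card_2_iff)
  \<comment> \<open>The images of \<open>p\<close> and \<open>q\<close> match \<open>b\<close> and
    \<open>c\<close> only as a set; the names may have to be swapped.\<close>
  with f(2) have "\<exists>p q. f = {p, q} \<and> rep V A p = b \<and> rep V A q = c"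
    by (auto simp: doubleton_eq_iff)
  then obtain p q where pq: "f = {p, q}" "rep V A p = b" "rep V A q = c"
    by blast
  with B[OF f(1)] have "p \<in> V" "q \<in> V" by auto
  have "(x, p) \<in> (adj (A \<union> B))\<^sup>*"
    using step.IH[of p] step.prems \<open>p \<in> V\<close> pq by blast
  also have "(p, q) \<in> adj (A \<union> B)"
    using f pq by (auto simp: adj_def)
  also have "(q, y) \<in> (adj (A \<union> B))\<^sup>*"
    using rep_eq_iff[of q y] adj_mono[of A "A \<union> B"] step.prems pq \<open>q \<in> V\<close> by auto
  finally show ?case .
qed

lemma contract_connected:
  assumes "(x, y) \<in> (adj (A \<union> B))\<^sup>*" "x \<in> V"
  shows "(rep V A x, rep V A y) \<in> (adj ((`) (rep V A) ` B))\<^sup>*"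
  using assms(1)
proof induction
  case (step y w)
  then have "{y, w} \<in> A \<or> {y, w} \<in> B" by (auto simp: adj_def)
  then show ?case
  proof
    assume "{y, w} \<in> A"
    then have "rep V A y = rep V A w"
      using A by (subst rep_eq_iff) (auto simp: adj_def)
    with step.IH show ?thesis by simp
  next
    assume "{y, w} \<in> B"
    then have "rep V A ` {y, w} \<in> (`) (rep V A) ` B" by (rule imageI)
    then have "(rep V A y, rep V A w) \<in> adj ((`) (rep V A) ` B)"
      by (simp add: adj_def)
    with step.IH show ?thesis by (rule rtrancl_into_rtrancl)
  qed
qed simp

lemma rep_image_cls:
  assumes "x \<in> V"
  shows "rep V A ` cls (A \<union> B) x = cls ((`) (rep V A) ` B) (rep V A x)"
proof -
  have sub: "cls ((`) (rep V A) ` B) (rep V A x) \<subseteq> rep V A ` V"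
    by (rule cls_subset) (use assms B in auto)
  show ?thesis
  proof (intro equalityI subsetI)
    fix a assume "a \<in> rep V A ` cls (A \<union> B) x"
    then obtain y where "a = rep V A y" "(x, y) \<in> (adj (A \<union> B))\<^sup>*"
      by (auto simp: cls_def)
    then show "a \<in> cls ((`) (rep V A) ` B) (rep V A x)"
      using contract_connected[of x y] assms by (simp add: cls_def)
  next
    fix a assume a: "a \<in> cls ((`) (rep V A) ` B) (rep V A x)"
    with sub obtain y where y: "y \<in> V" "a = rep V A y"
      by blast
    with a have "(x, y) \<in> (adj (A \<union> B))\<^sup>*"
      using assms by (intro contract_connected_imp[of "rep V A x" a]) (auto simp: cls_def)
    with y show "a \<in> rep V A ` cls (A \<union> B) x"
      by (auto simp: cls_def)
  qed
qed

text \<open>A component of \<open>A \<union> B\<close> is the disjoint union of the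
  \<open>A\<close>-classes of its representatives, so summing the merged marks merely regroups the
  dot-sum.\<close>

lemma dot_sum_contract:
  assumes "finite V" "x \<in> V"
  shows "dot_sum (\<lambda>v. dot_sum m (reach V A `` {v})) (rep V A ` cls (A \<union> B) x) =
    dot_sum m (cls (A \<union> B) x)"
proof -
  let ?C = "cls (A \<union> B) x"
  have C: "?C \<subseteq> V"
    by (rule cls_subset) (use assms A B in auto)
  have sub: "cls A y \<subseteq> cls (A \<union> B) y" for y
    using adj_mono[of A "A \<union> B"] by (auto simp: cls_def)
  have "?C = (\<Union>v\<in>rep V A ` ?C. cls A v)"
  proof -
    have "y \<in> cls A (rep V A y)" "cls A (rep V A y) \<subseteq> ?C" if "y \<in> ?C" for y
    proof -
      have "y \<in> V"
        using that C by blast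
      moreover have "cls (A \<union> B) y = ?C"
        using that by (simp add: mem_cls_iff)
      ultimately show "y \<in> cls A (rep V A y)" "cls A (rep V A y) \<subseteq> ?C"
        using sub[of y] by (simp_all add: cls_rep)
    qed
    then show ?thesis by blast
  qed
  then have "dot_sum m ?C = dot_sum m (\<Union>v\<in>rep V A ` ?C. cls A v)"
    by simp
  also have "\<dots> = dot_sum (\<lambda>v. dot_sum m (cls A v)) (rep V A ` ?C)"
  proof (rule dot_sum.UNION_disjoint)
    show "finite (rep V A ` ?C)"
      using C assms finite_subset by blast
    show "\<forall>v\<in>rep V A ` ?C. finite (cls A v)"
    proof
      fix v assume "v \<in> rep V A ` ?C"
      then have "v \<in> V"
        using C rep_in_V by auto
      then show "finite (cls A v)"
        using cls_subset_V finite_subset assms by metis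
    qed
    show "\<forall>v\<in>rep V A ` ?C. \<forall>w\<in>rep V A ` ?C. v \<noteq> w \<longrightarrow> cls A v \<inter> cls A w = {}"
    proof (intro ballI impI)
      fix v w assume "v \<in> rep V A ` ?C" "w \<in> rep V A ` ?C" "v \<noteq> w"
      then obtain y y' where y: "v = rep V A y" "w = rep V A y'" "y \<in> V" "y' \<in> V"
        using C by blast
      with \<open>v \<noteq> w\<close> have "cls A y \<noteq> cls A y'"
        by (simp add: rep_eq_iff cls_eq_iff)
      with y show "cls A v \<inter> cls A w = {}"
        using cls_rep by (auto simp: mem_cls_iff)
    qed
  qed
  also have "\<dots> = dot_sum (\<lambda>v. dot_sum m (reach V A `` {v})) (rep V A ` ?C)"
  proof (rule dot_sum.cong[OF refl])
    fix v assume "v \<in> rep V A ` ?C"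
    then have "v \<in> V"
      using C rep_in_V by auto
    then show "dot_sum m (cls A v) = dot_sum m (reach V A `` {v})"
      by (simp add: reach_Image[OF A])
  qed
  finally show ?thesis by simp
qed

lemma prod_components_contract:
  assumes "finite V"
  shows "(\<Prod>C\<in>components (rep V A ` V) ((`) (rep V A) ` B).
      (g :: mark \<Rightarrow> 'b::comm_ring_1) (dot_sum (\<lambda>v. dot_sum m (reach V A `` {v})) C)) =
    (\<Prod>C\<in>components V (A \<union> B). g (dot_sum m C))"
proof -
  have 1: "components V (A \<union> B) = cls (A \<union> B) ` V"
    using A B by (intro components_eq) auto
  have "components (rep V A ` V) ((`) (rep V A) ` B) = cls ((`) (rep V A) ` B) ` rep V A ` V"
    using B by (intro components_eq) auto
  also have "\<dots> = (`) (rep V A) ` components V (A \<union> B)"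
    unfolding 1 image_image by (intro image_cong) (simp_all add: rep_image_cls)
  finally have 2: "components (rep V A ` V) ((`) (rep V A) ` B) = (`) (rep V A) ` components V (A \<union> B)" .
  \<comment> \<open>Equal images are joined by a walk in the quotient, whose lift joins the two
    components.\<close>
  have "inj_on ((`) (rep V A)) (components V (A \<union> B))"
  proof (rule inj_onI)
    fix C C' assume C: "C \<in> components V (A \<union> B)" "C' \<in> components V (A \<union> B)"
      "rep V A ` C = rep V A ` C'"
    then obtain x x' where x: "C = cls (A \<union> B) x" "C' = cls (A \<union> B) x'" "x \<in> V" "x' \<in> V"
      by (auto simp: 1)
    then have "cls ((`) (rep V A) ` B) (rep V A x) = cls ((`) (rep V A) ` B) (rep V A x')"
      using C by (simp add: rep_image_cls)
    then show "C = C'"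
      using contract_connected_imp x by (auto simp: cls_eq_iff)
  qed
  then show ?thesis
    unfolding 2 using dot_sum_contract[OF assms]
    by (subst prod.reindex) (auto simp: 1 intro!: prod.cong)
qed

end

end

lemma all_bridges_adjD: "all_bridges E \<Longrightarrow> {x, y} \<in> E \<Longrightarrow> (x, y) \<in> (adj F)\<^sup>* \<Longrightarrow> F \<subseteq> E - {{x, y}} \<Longrightarrow> False"
  unfolding all_bridges_def using adj_mono by blast

text \<open>If \<open>e\<close> and \<open>f\<close> had the same image, the ends of
  \<open>e\<close> could be joined through \<open>A\<close> and \<open>f\<close>, a detour around
  \<open>e\<close>.\<close>

lemma inj_on_rep_edges:
  assumes "bridge_forest (V, E, m)" "A \<subseteq> E"
  shows "inj_on ((`) (rep V A)) (E - A)"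
proof (rule inj_onI, rule ccontr)
  fix e f assume e: "e \<in> E - A" and f: "f \<in> E - A" and ef: "rep V A ` e = rep V A ` f" "e \<noteq> f"
  obtain x y where xy: "e = {x, y}" "x \<in> V" "y \<in> V"
    using bridge_forest_edge[OF assms(1)] e by (metis DiffD1)
  have V: "A \<subseteq> Pow V" "x \<in> V" "y \<in> V"
    using bridge_forest_edges_subset[OF assms(1)] assms(2) xy by auto
  have "(rep V A x, rep V A y) \<in> (adj ((`) (rep V A) ` {f}))\<^sup>*"
    using ef xy by (auto simp: adj_def)
  then have "(x, y) \<in> (adj (A \<union> {f}))\<^sup>*"
    using V assms f by (intro contract_connected_imp[OF V(1), where B = "{f}"]) auto
  then show False
    by (rule all_bridges_adjD[of E, rotated 2]) (use assms e f xy ef in auto)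
qed

text \<open>A detour around an edge after contraction lifts to a detour around the original
  edge.\<close>

lemma bridge_forest_contract:
  assumes bf: "bridge_forest (V, E, m)" and A: "A \<subseteq> E"
  shows "bridge_forest (contract_delete (V, E, m) A F)"
proof -
  have AV: "A \<subseteq> Pow V"
    using bridge_forest_edges_subset[OF bf] A by blast
  let ?R = "rep V A"
  have marks: "dot_sum m (reach V A `` {?R x}) \<in> marks" if "x \<in> V" for x
  proof -
    have sub: "cls A (?R x) \<subseteq> V"
      using that cls_subset_V[OF AV rep_in_V[OF AV]] by blast
    then have "m ` cls A (?R x) \<subseteq> marks" "finite (cls A (?R x))"
      using bf by (meson bridge_forest.simps image_mono order_trans finite_subset)+
    then show ?thesis
      unfolding reach_Image[OF AV rep_in_V[OF AV that]] by (intro dot_sum_marks) simp_all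
  qed
  \<comment> \<open>No surviving edge collapses to a loop, for otherwise \<open>A\<close> alone
    would join its ends.\<close>
  have two: "?R ` e \<subseteq> ?R ` V \<and> card (?R ` e) = 2" if e: "e \<in> E - A - F" for e
  proof -
    obtain x y where xy: "e = {x, y}" and V: "x \<in> V" "y \<in> V"
      using bridge_forest_edge[OF bf] e by (metis DiffD1)
    have "(x, y) \<notin> (adj A)\<^sup>*"
    proof
      assume "(x, y) \<in> (adj A)\<^sup>*"
      then show False
        by (rule all_bridges_adjD[of E, rotated 2]) (use assms e xy in auto)
    qed
    then have "?R x \<noteq> ?R y"
      using rep_eq_iff[OF AV V] by simp
    with xy V show ?thesis by auto
  qed
  have "all_bridges ((`) ?R ` (E - A - F))"
    unfolding all_bridges_def
  proof (intro allI impI notI)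
    fix a b assume ab: "{a, b} \<in> (`) ?R ` (E - A - F)"
      and path: "(a, b) \<in> (adj ((`) ?R ` (E - A - F) - {{a, b}}))\<^sup>*"
    then obtain e where e: "e \<in> E - A - F" "{a, b} = ?R ` e" by blast
    obtain p q where "e = {p, q}"
      using bridge_forest_edge[OF bf] e(1) by (metis DiffD1)
    with e(2) have "\<exists>x y. e = {x, y} \<and> ?R x = a \<and> ?R y = b"
      by (auto simp: doubleton_eq_iff)
    then obtain x y where xy: "e = {x, y}" "?R x = a" "?R y = b"
      by blast
    have V: "x \<in> V" "y \<in> V"
      using bf e xy by auto
    let ?B = "E - A - F - {e}"
    have "(`) ?R ` (E - A - F) - {{a, b}} \<subseteq> (`) ?R ` ?B"
      unfolding e(2) by blast
    then have "(a, b) \<in> (adj ((`) ?R ` ?B))\<^sup>*"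
      using path by (rule subsetD[OF adj_mono])
    then have "(x, y) \<in> (adj (A \<union> ?B))\<^sup>*"
      by (rule contract_connected_imp[OF AV _ _ V(1) xy(2) V(2) xy(3), rotated]) (use bf in auto)
    then show False
      by (rule all_bridges_adjD[of E, rotated 2]) (use assms e xy in auto)
  qed
  moreover have "finite (?R ` V)" "?R ` V \<noteq> {}"
    using bf by auto
  moreover have "(\<lambda>v. dot_sum m (reach V A `` {v})) ` ?R ` V \<subseteq> marks"
    using marks by blast
  ultimately show ?thesis
    using two unfolding contract_delete.simps bridge_forest.simps by blast
qed

text \<open>An edge set is split into its part inside \<open>F\<close>, which is contracted while
  the rest of \<open>F\<close> is deleted, and its part outside \<open>F\<close>, which becomes an
  edge set of the resulting forest.\<close>

lemma weight_sum_contract: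
  assumes bf: "bridge_forest (V, E, m)" and F: "F \<subseteq> E"
  shows "weight_sum g (V, E, m) = (\<Sum>A\<in>Pow F. weight_sum g (contract_delete (V, E, m) A (F - A)))"
proof -
  let ?f = "\<lambda>A. \<Prod>C\<in>components V A. g (dot_sum m C)"
  have "weight_sum g (contract_delete (V, E, m) A (F - A)) = (\<Sum>B\<in>Pow (E - F). ?f (A \<union> B))"
    if A: "A \<in> Pow F" for A
  proof -
    let ?R = "rep V A"
    have EF: "E - A - (F - A) = E - F"
      using A by auto
    \<comment> \<open>Needed to identify the edge sets of the contracted forest with the subsets of
      \<open>E - F\<close>, each counted once.\<close>
    have inj: "inj_on ((`) ?R) (E - F)"
      using inj_on_rep_edges[OF bf, of A] A F by (blast intro: inj_on_subset)
    have "Pow ((`) ?R ` (E - F)) = (`) ((`) ?R) ` Pow (E - F)"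
      by (simp add: image_Pow_surj)
    then have "weight_sum g (contract_delete (V, E, m) A (F - A)) =
       (\<Sum>B\<in>Pow (E - F). \<Prod>C\<in>components (?R ` V) ((`) ?R ` B).
          g (dot_sum (\<lambda>v. dot_sum m (reach V A `` {v})) C))"
      by (simp add: EF sum.reindex inj_on_image_Pow[OF inj])
    also have "\<dots> = (\<Sum>B\<in>Pow (E - F). ?f (A \<union> B))"
    proof (intro sum.cong refl prod_components_contract)
      show "A \<subseteq> Pow V" "finite V"
        using bridge_forest_edges_subset[OF bf] bf A F by auto
    qed (use bf in auto)
    finally show ?thesis .
  qed
  then have "(\<Sum>A\<in>Pow F. weight_sum g (contract_delete (V, E, m) A (F - A))) =
      (\<Sum>A\<in>Pow F. \<Sum>B\<in>Pow (E - F). ?f (A \<union> B))"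
    by (rule sum.cong[OF refl])
  also have "\<dots> = (\<Sum>(A, B)\<in>Pow F \<times> Pow (E - F). ?f (A \<union> B))"
    by (rule sum.cartesian_product)
  also have "\<dots> = (\<Sum>A\<in>Pow E. ?f A)"
    by (rule sum.reindex_bij_witness[where i = "\<lambda>A. (A \<inter> F, A - F)" and j = "\<lambda>(A, B). A \<union> B"])
      (use F in \<open>auto simp: Int_Diff_Un Int_Un_distrib2\<close>)
  finally show ?thesis
    by simp
qed

section \<open>Connected components\<close>

lemma components_Un:
  assumes "A \<subseteq> Pow V" "V = \<Union>P" "disjoint P" "\<And>e. e \<in> A \<Longrightarrow> \<exists>C\<in>P. e \<subseteq> C"
  shows "components V A = (\<Union>C\<in>P. components C {e \<in> A. e \<subseteq> C})"
proof -
  have "cls A x = cls {e \<in> A. e \<subseteq> C} x" if "C \<in> P" "x \<in> C" for x C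
  proof (rule cls_cong[OF that(2)])
    fix e assume "e \<in> A" "e \<inter> C \<noteq> {}"
    moreover obtain C' where "C' \<in> P" "e \<subseteq> C'"
      using assms(4) \<open>e \<in> A\<close> by blast
    ultimately have "C' \<inter> C \<noteq> {}"
      by blast
    with \<open>disjoint P\<close> \<open>C' \<in> P\<close> \<open>C \<in> P\<close> have "C' = C"
      by (auto simp: disjoint_def)
    with \<open>e \<subseteq> C'\<close> show "e \<subseteq> C"
      by simp
  qed auto
  moreover have "components C {e \<in> A. e \<subseteq> C} = cls {e \<in> A. e \<subseteq> C} ` C" for C
    by (rule components_eq) auto
  ultimately have "components C {e \<in> A. e \<subseteq> C} = cls A ` C" if "C \<in> P" for C
    using that by auto
  then have "(\<Union>C\<in>P. components C {e \<in> A. e \<subseteq> C}) = (\<Union>C\<in>P. cls A ` C)"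
    by auto
  also have "\<dots> = components V A"
    unfolding components_eq[OF assms(1)] using assms(2) by blast
  finally show ?thesis ..
qed

lemma components_memD:
  assumes "A \<subseteq> Pow V" "D \<in> components V A"
  shows "D \<subseteq> V" "D \<noteq> {}"
proof -
  obtain x where x: "x \<in> V" "D = cls A x"
    using assms by (auto simp: components_eq)
  show "D \<subseteq> V"
    unfolding x by (rule cls_subset) (use assms x in auto)
  show "D \<noteq> {}"
    unfolding x by simp
qed

text \<open>An edge set amounts to an independent choice of a set inside each block, and the product
  over components factors accordingly; expanding the product of sums over choice functions gives the
  sum over edge sets.\<close>

lemma weight_sum_Un:
  fixes V :: "'a set"
  assumes fin: "finite V" and E: "E \<subseteq> Pow V" and V: "V = \<Union>P" and P: "disjoint P"
    and EP: "\<And>e. e \<in> E \<Longrightarrow> e \<noteq> {} \<and> (\<exists>C\<in>P. e \<subseteq> C)"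
  shows "weight_sum g (V, E, m) = (\<Prod>C\<in>P. weight_sum g (C, {e \<in> E. e \<subseteq> C}, m))"
proof -
  let ?h = "\<lambda>V A. \<Prod>C\<in>components V A. g (dot_sum m C)"
  have finE: "finite E"
    using E fin by (meson finite_Pow_iff finite_subset)
  have finP: "finite P"
    using V fin finite_UnionD by blast
  have finC: "finite C" if "C \<in> P" for C
    using V fin that by (metis Union_upper finite_subset)
  \<comment> \<open>Edges are nonempty, so each lies in a single block; this lets a family be
    recovered from its union.\<close>
  have uniq: "C = C'" if "e \<in> E" "e \<subseteq> C" "e \<subseteq> C'" "C \<in> P" "C' \<in> P" for e C C'
  proof -
    have "C \<inter> C' \<noteq> {}" using that EP by blast
    with P that show ?thesis by (auto simp: disjoint_def)
  qed
  have prod_h: "?h V A = (\<Prod>C\<in>P. ?h C {e \<in> A. e \<subseteq> C})" if "A \<subseteq> E" for A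
  proof -
    have sub: "{e \<in> A. e \<subseteq> C} \<subseteq> Pow C" for C
      by auto
    have "components V A = (\<Union>C\<in>P. components C {e \<in> A. e \<subseteq> C})"
      using that E EP by (intro components_Un[OF _ V P]) blast+
    then have "?h V A = (\<Prod>D\<in>(\<Union>C\<in>P. components C {e \<in> A. e \<subseteq> C}). g (dot_sum m D))"
      by simp
    also have "\<dots> = (\<Prod>C\<in>P. ?h C {e \<in> A. e \<subseteq> C})"
    proof (rule prod.UNION_disjoint[OF finP])
      show "\<forall>C\<in>P. finite (components C {e \<in> A. e \<subseteq> C})"
        using finC by (auto simp: components_eq[OF sub])
      show "\<forall>C\<in>P. \<forall>C'\<in>P. C \<noteq> C' \<longrightarrow> components C {e \<in> A. e \<subseteq> C} \<inter> components C' {e \<in> A. e \<subseteq> C'} = {}"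
      proof (intro ballI impI equals0I)
        fix C C' D assume C: "C \<in> P" "C' \<in> P" "C \<noteq> C'"
          "D \<in> components C {e \<in> A. e \<subseteq> C} \<inter> components C' {e \<in> A. e \<subseteq> C'}"
        then have "D \<subseteq> C" "D \<subseteq> C'" "D \<noteq> {}"
          using components_memD[OF sub] by blast+
        moreover have "C \<inter> C' = {}"
          using disjointD[OF P C(1-3)] .
        ultimately show False by blast
      qed
    qed
    finally show ?thesis .
  qed
  have "(\<Prod>C\<in>P. weight_sum g (C, {e \<in> E. e \<subseteq> C}, m)) =
      (\<Prod>C\<in>P. \<Sum>B\<in>Pow {e \<in> E. e \<subseteq> C}. ?h C B)"
    by simp
  also have "\<dots> = (\<Sum>f\<in>(\<Pi>\<^sub>E C\<in>P. Pow {e \<in> E. e \<subseteq> C}). \<Prod>C\<in>P. ?h C (f C))"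
    using finP finE by (intro prod_sum_PiE) auto
  also have "\<dots> = (\<Sum>A\<in>Pow E. ?h V A)"
  proof (rule sum.reindex_bij_witness[where i = "\<lambda>A. \<lambda>C\<in>P. {e \<in> A. e \<subseteq> C}" and j = "\<lambda>f. \<Union>C\<in>P. f C"])
    fix f assume f: "f \<in> (\<Pi>\<^sub>E C\<in>P. Pow {e \<in> E. e \<subseteq> C})"
    have fC: "{e \<in> \<Union>C\<in>P. f C. e \<subseteq> C} = f C" if "C \<in> P" for C
    proof
      show "f C \<subseteq> {e \<in> \<Union>C\<in>P. f C. e \<subseteq> C}"
        using that PiE_mem[OF f that] by blast
      show "{e \<in> \<Union>C\<in>P. f C. e \<subseteq> C} \<subseteq> f C"
      proof
        fix e assume "e \<in> {e \<in> \<Union>C\<in>P. f C. e \<subseteq> C}"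
        then obtain C' where C': "C' \<in> P" "e \<in> f C'" "e \<subseteq> C" by blast
        then have "e \<in> E" "e \<subseteq> C'"
          using PiE_mem[OF f C'(1)] by blast+
        with C' that have "C = C'" using uniq by blast
        with C' show "e \<in> f C" by simp
      qed
    qed
    show "(\<lambda>C\<in>P. {e \<in> \<Union>C\<in>P. f C. e \<subseteq> C}) = f"
    proof
      fix C show "(\<lambda>C\<in>P. {e \<in> \<Union>C\<in>P. f C. e \<subseteq> C}) C = f C"
        using fC[of C] PiE_arb[OF f, of C] by (cases "C \<in> P") auto
    qed
    show "(\<Union>C\<in>P. f C) \<in> Pow E"
      using PiE_mem[OF f] by blast
    then show "?h V (\<Union>C\<in>P. f C) = (\<Prod>C\<in>P. ?h C (f C))"
      using fC by (subst prod_h) (auto intro!: prod.cong)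
  next
    fix A assume "A \<in> Pow E"
    then show "(\<Union>C\<in>P. (\<lambda>C\<in>P. {e \<in> A. e \<subseteq> C}) C) = A"
      using EP by auto
    show "(\<lambda>C\<in>P. {e \<in> A. e \<subseteq> C}) \<in> (\<Pi>\<^sub>E C\<in>P. Pow {e \<in> E. e \<subseteq> C})"
      using \<open>A \<in> Pow E\<close> by auto
  qed
  finally show ?thesis
    by simp
qed

lemma components_partition:
  assumes "bridge_forest (V, E, m)"
  shows "\<Union>(components V E) = V" "disjoint (components V E)"
    "e \<in> E \<Longrightarrow> \<exists>C\<in>components V E. e \<subseteq> C"
proof -
  note E = bridge_forest_edges_subset[OF assms]
  show "\<Union>(components V E) = V"
  proof
    show "\<Union>(components V E) \<subseteq> V"
      using components_memD(1)[OF E] by blast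
    show "V \<subseteq> \<Union>(components V E)"
      unfolding components_eq[OF E] using cls_self by (metis UN_I subsetI)
  qed
  show "disjoint (components V E)"
    unfolding components_eq[OF E]
  proof (rule disjointI)
    fix C C' assume "C \<in> cls E ` V" "C' \<in> cls E ` V" "C \<noteq> C'"
    then obtain x x' where x: "C = cls E x" "C' = cls E x'" "cls E x \<noteq> cls E x'"
      by blast
    show "C \<inter> C' = {}"
    proof (rule equals0I)
      fix y assume "y \<in> C \<inter> C'"
      then have "y \<in> cls E x" "y \<in> cls E x'"
        using x(1,2) by simp_all
      with x(3) show False by (simp add: mem_cls_iff)
    qed
  qed
  assume e: "e \<in> E"
  then obtain x y where xy: "e = {x, y}" "x \<in> V" "y \<in> V"
    using bridge_forest_edge[OF assms] by metis
  then have "e \<subseteq> cls E x"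
    using e by (auto simp: cls_def adj_def)
  with xy show "\<exists>C\<in>components V E. e \<subseteq> C"
    unfolding components_eq[OF E] by blast
qed

lemma weight_sum_components:
  assumes "bridge_forest (V, E, m)"
  shows "weight_sum g (V, E, m) = (\<Prod>C\<in>components V E. weight_sum g (C, {e \<in> E. e \<subseteq> C}, m))"
proof (rule weight_sum_Un)
  show "finite V" "E \<subseteq> Pow V" "V = \<Union>(components V E)" "disjoint (components V E)"
    using assms components_partition[OF assms] by auto
  show "e \<noteq> {} \<and> (\<exists>C\<in>components V E. e \<subseteq> C)" if "e \<in> E" for e
    using components_partition(3)[OF assms that] assms that by auto
qed

lemma bridge_forest_component:
  assumes "bridge_forest (V, E, m)" "C \<in> components V E"
  shows "bridge_forest (C, {e \<in> E. e \<subseteq> C}, m)"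
proof -
  have "C \<subseteq> V" "C \<noteq> {}"
    using components_memD[OF bridge_forest_edges_subset[OF assms(1)] assms(2)] by auto
  moreover have "all_bridges {e \<in> E. e \<subseteq> C}"
    using assms(1) by (auto intro: all_bridges_mono[of E])
  moreover have "finite C" "m ` C \<subseteq> marks"
    using assms(1) \<open>C \<subseteq> V\<close> by (meson bridge_forest.simps image_mono order_trans finite_subset)+
  ultimately show ?thesis
    using assms(1) by auto
qed

section \<open>Absorption\<close>

text \<open>Since \<open>v\<close> is isolated in \<open>A\<close>, the new edge only hangs
  \<open>v\<close> onto the class of \<open>u\<close>.\<close>

lemma cls_insert_edge:
  assumes A: "\<And>e. e \<in> A \<Longrightarrow> v \<notin> e \<and> card e = 2"
  shows "cls (insert {u, v} A) x =
    (if x \<in> insert v (cls A u) then insert v (cls A u) else cls A x)"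
proof -
  let ?A = "insert {u, v} A"
  have mono: "cls A y \<subseteq> cls ?A y" for y
    using adj_mono[of A ?A] by (auto simp: cls_def)
  have closed: "e \<subseteq> cls A y" if eA: "e \<in> A" "e \<inter> cls A y \<noteq> {}" for e y
  proof -
    obtain p q where e: "e = {p, q}"
      using A[OF eA(1)] by (auto simp: card_2_iff)
    then have "cls A p = cls A q"
      using eA(1) by (auto simp: cls_eq_iff adj_def)
    with eA(2) show ?thesis
      unfolding e by (auto simp: mem_cls_iff)
  qed
  have uv: "cls ?A u = cls ?A v"
    by (auto simp: cls_eq_iff adj_def)
  have sup: "insert v (cls A u) \<subseteq> cls ?A u"
    using mono[of u] uv by (simp add: mem_cls_iff[of v])
  have sub: "cls ?A u \<subseteq> insert v (cls A u)"
  proof (rule cls_subset)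
    fix e assume "e \<in> ?A" "e \<inter> insert v (cls A u) \<noteq> {}"
    then show "e \<subseteq> insert v (cls A u)"
      using A[of e] closed[of e u] by auto
  qed simp
  show ?thesis
  proof (cases "x \<in> insert v (cls A u)")
    case True
    with sup have "cls ?A x = cls ?A u"
      unfolding mem_cls_iff[symmetric] by blast
    with True sub sup show ?thesis
      by auto
  next
    case False
    then have "u \<notin> cls A x"
      by (auto simp: mem_cls_iff)
    moreover have "v \<notin> cls A x"
    proof
      assume "v \<in> cls A x"
      then have "x \<in> cls A v" by (simp add: mem_cls_iff)
      moreover have "cls A v = {v}" using A by (intro cls_no_edge) auto
      ultimately show False using False by simp
    qed
    ultimately have "cls ?A x \<subseteq> cls A x"
      using closed by (intro cls_subset) auto
    with False mono[of x] show ?thesis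
      by auto
  qed
qed

lemma prod_components_absorb:
  assumes fin: "finite V" and marks: "m ` V \<subseteq> marks"
    and A: "\<And>e. e \<in> A \<Longrightarrow> e \<subseteq> V \<and> v \<notin> e \<and> card e = 2"
    and uv: "u \<in> V" "v \<in> V" "u \<noteq> v" and mv: "m v = (1, 0)" and mu: "m u = (w, d)"
  shows "(\<Prod>C\<in>components (V - {v}) A. D_bullet (dot_sum (m(u := (w + 1, d))) C)) =
    (\<Prod>C\<in>components V A. D_bullet (dot_sum m C)) +
    (\<Prod>C\<in>components V (insert {u, v} A). D_bullet (dot_sum m C))"
proof -
  \<comment> \<open>The components that avoid both \<open>u\<close> and \<open>v\<close>; they occur
    on both sides with the same weights and are factored out.\<close>
  let ?K = "components (V - {v}) A - {cls A u}"
  let ?h = "\<lambda>C. D_bullet (dot_sum m C)"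
  have comps: "components (V - {v}) A = cls A ` (V - {v})" "components V A = cls A ` V"
    "components V (insert {u, v} A) = cls (insert {u, v} A) ` V"
    by (rule components_eq; use A uv in auto)+
  have v: "cls A v = {v}"
    using A by (intro cls_no_edge) auto
  have sub: "cls A x \<subseteq> V - {v}" if "x \<in> V - {v}" for x
    by (rule cls_subset[OF that]) (use A in auto)
  have finK: "finite ?K"
    using fin by (simp add: comps)
  have U: "cls A u \<subseteq> V - {v}" "finite (cls A u)"
    using sub[of u] uv fin finite_subset[of "cls A u" V] by auto
  have K: "u \<notin> C" "v \<notin> C" if "C \<in> ?K" for C
  proof -
    from that obtain x where x: "x \<in> V - {v}" "C = cls A x" "C \<noteq> cls A u"
      by (auto simp: comps)
    then show "v \<notin> C"
      using sub[of x] by blast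
    show "u \<notin> C"
      using x(2,3) by (auto simp: mem_cls_iff)
  qed
  have "cls A u \<in> components (V - {v}) A"
    using uv by (simp add: comps)
  then have 0: "components (V - {v}) A = insert (cls A u) ?K"
    by blast
  have "components V A = insert {v} (components (V - {v}) A)"
    using uv image_insert[of "cls A" v "V - {v}"] by (simp add: comps v insert_absorb)
  then have 1: "components V A = insert {v} (insert (cls A u) ?K)"
    using 0 by simp
  have 2: "components V (insert {u, v} A) = insert (insert v (cls A u)) ?K"
  proof -
    have "cls (insert {u, v} A) x = (if x \<in> insert v (cls A u) then insert v (cls A u) else cls A x)" for x
      using A by (intro cls_insert_edge) auto
    then have "components V (insert {u, v} A) =
        (\<lambda>x. if x \<in> insert v (cls A u) then insert v (cls A u) else cls A x) ` V"
      by (simp add: comps)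
    also have "\<dots> = insert (insert v (cls A u)) (cls A ` (V - insert v (cls A u)))"
      using uv by (auto simp: image_iff)
    also have "cls A ` (V - insert v (cls A u)) = ?K"
    proof (intro equalityI subsetI)
      fix C assume "C \<in> cls A ` (V - insert v (cls A u))"
      then show "C \<in> ?K"
        unfolding comps by (auto simp: mem_cls_iff)
    next
      fix C assume "C \<in> ?K"
      then obtain x where "x \<in> V - {v}" "C = cls A x" "cls A x \<noteq> cls A u"
        unfolding comps by blast
      then show "C \<in> cls A ` (V - insert v (cls A u))"
        by (auto simp: mem_cls_iff)
    qed
    finally show ?thesis .
  qed
  obtain W d' where Wd: "dot_sum m (cls A u) = (W, d')"
    by (rule prod.exhaust)
  have "dot_sum m (cls A u) \<in> marks"
  proof (rule dot_sum_marks[OF U(2)])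
    show "cls A u \<noteq> {}" by simp
    show "m ` cls A u \<subseteq> marks"
      using image_mono[of "cls A u" V m] U(1) marks by (meson Diff_subset order_trans)
  qed
  then have "d' \<ge> 0"
    by (simp add: Wd marks_def)
  \<comment> \<open>Raising the first coordinate of one mark by 1 raises that of the dot-sum by 1
    and keeps the second.\<close>
  have "dot_sum (m(u := (w + 1, d))) (cls A u) =
      dotplus (w + 1, d) (dot_sum (m(u := (w + 1, d))) (cls A u - {u}))"
    using U by (subst dot_sum.remove[of _ u]) auto
  also have "dot_sum (m(u := (w + 1, d))) (cls A u - {u}) = dot_sum m (cls A u - {u})"
    by (rule dot_sum.cong) auto
  also have "dotplus (w + 1, d) (dot_sum m (cls A u - {u})) = (W + 1, d')"
    using dot_sum.remove[of "cls A u" u m] U Wd mu by (auto simp: dotplus_def)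
  finally have sum_abs: "dot_sum (m(u := (w + 1, d))) (cls A u) = (W + 1, d')" .
  \<comment> \<open>Joining \<open>v\<close> by the edge also raises the second coordinate, through
    the \<open>+ 1\<close> in \<open>dotplus\<close>.\<close>
  have sum_ins: "dot_sum m (insert v (cls A u)) = (W + 1, d' + 1)"
    using U Wd mv by (subst dot_sum.insert) (auto simp: dotplus_def)
  have "(\<Prod>C\<in>components (V - {v}) A. D_bullet (dot_sum (m(u := (w + 1, d))) C)) =
      D_bullet (W + 1, d') * (\<Prod>C\<in>?K. D_bullet (dot_sum (m(u := (w + 1, d))) C))"
    by (subst 0, subst prod.insert) (use finK sum_abs in auto)
  also have "(\<Prod>C\<in>?K. D_bullet (dot_sum (m(u := (w + 1, d))) C)) = (\<Prod>C\<in>?K. ?h C)"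
  proof (rule prod.cong[OF refl])
    fix C assume "C \<in> ?K"
    then have "dot_sum (m(u := (w + 1, d))) C = dot_sum m C"
      using K(1) by (intro dot_sum.cong) auto
    then show "D_bullet (dot_sum (m(u := (w + 1, d))) C) = ?h C"
      by simp
  qed
  also have "D_bullet (W + 1, d') = D_bullet (W + 1, d' + 1) + D_bullet (W, d') * D_bullet (1, 0)"
    using \<open>d' \<ge> 0\<close> by (rule D_bullet_absorb)
  also have "(D_bullet (W + 1, d' + 1) + D_bullet (W, d') * D_bullet (1, 0)) * (\<Prod>C\<in>?K. ?h C) =
      D_bullet (1, 0) * (D_bullet (W, d') * (\<Prod>C\<in>?K. ?h C)) + D_bullet (W + 1, d' + 1) * (\<Prod>C\<in>?K. ?h C)"
    by (simp add: distrib_right mult_ac)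
  also have "D_bullet (1, 0) * (D_bullet (W, d') * (\<Prod>C\<in>?K. ?h C)) = (\<Prod>C\<in>components V A. ?h C)"
  proof -
    have v_new: "{v} \<notin> insert (cls A u) ?K"
      using K(2) U by auto
    have u_new: "cls A u \<notin> ?K"
      by blast
    have "(\<Prod>C\<in>insert {v} (insert (cls A u) ?K). ?h C) = ?h {v} * (?h (cls A u) * (\<Prod>C\<in>?K. ?h C))"
      by (simp only: prod.insert[OF _ v_new] prod.insert[OF finK u_new] finite_insert finK)
    moreover have "dot_sum m {v} = (1, 0)"
      using mv by simp
    ultimately show ?thesis
      by (simp only: 1 Wd)
  qed
  also have "D_bullet (W + 1, d' + 1) * (\<Prod>C\<in>?K. ?h C) = (\<Prod>C\<in>components V (insert {u, v} A). ?h C)"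
  proof -
    have "insert v (cls A u) \<notin> ?K"
      using K(2) by blast
    then show ?thesis
      unfolding 2 using finK sum_ins by (subst prod.insert) simp_all
  qed
  finally show ?thesis .
qed

section \<open>Single absorptions and their termination\<close>

lemma degree_1_edge_unique:
  assumes "degree E v = 1" "e \<in> E" "v \<in> e" "f \<in> E" "v \<in> f"
  shows "e = f"
proof -
  obtain a where "{e \<in> E. v \<in> e} = {a}"
    using assms(1) by (auto simp: degree_def card_1_singleton_iff)
  moreover have "e \<in> {e \<in> E. v \<in> e}" "f \<in> {e \<in> E. v \<in> e}"
    using assms by simp_all
  ultimately show ?thesis by simp
qed

text \<open>Passing to a component may keep all edges but loses a vertex, while an expansion with
  nothing contracted keeps all vertices but loses edges; the sum drops in both cases.\<close>

fun graph_size :: "'a mgraph \<Rightarrow> nat" where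
  "graph_size (V, E, m) = card V + card E"

lemma absorb_step:
  assumes "absorb T T'" "bridge_forest T"
  shows "bridge_forest T'" "weight_sum D_bullet T' = weight_sum D_bullet T" "graph_size T' < graph_size T"
proof -
  obtain V E m v u w d where T: "T = (V, E, m)" and v: "absorbable (V, E, m) v"
    and uv: "{u, v} \<in> E" and mu: "m u = (w, d)"
    and T': "T' = (V - {v}, E - {{u, v}}, m(u := (w + 1, d)))"
    using assms(1) by (auto elim: absorb.cases)
  note bf = assms(2)[unfolded T]
  have "card {u, v} = 2" "u \<in> V" "v \<in> V"
    using bf uv by auto
  then have "u \<noteq> v" by auto
  have E': "v \<notin> e" if "e \<in> E - {{u, v}}" for e
    using that v uv degree_1_edge_unique[of E v e "{u, v}"] by auto
  have finE: "finite E"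
    using bf finite_subset[OF bridge_forest_edges_subset[OF bf]] by simp
  have "(w, d) \<in> marks" "m ` V \<subseteq> marks"
    using bf \<open>u \<in> V\<close> mu by (auto simp: image_subset_iff simp del: split_paired_All)
  then have "m(u := (w + 1, d)) ` (V - {v}) \<subseteq> marks"
    by (auto simp: marks_def)
  moreover have "all_bridges (E - {{u, v}})"
    using bf by (auto intro: all_bridges_mono[of E])
  ultimately show "bridge_forest T'"
    unfolding T' using bf E' \<open>u \<in> V\<close> \<open>u \<noteq> v\<close> by auto
  show "graph_size T' < graph_size T"
    unfolding T T' graph_size.simps using bf \<open>v \<in> V\<close> finE
    by (intro add_less_le_mono card_Diff1_less card_Diff1_le) auto
  let ?h = "\<lambda>A. \<Prod>C\<in>components V A. D_bullet (dot_sum m C)"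
  \<comment> \<open>Each edge set of \<open>T'\<close> stands for two edge sets of \<open>T\<close>,
    without and with \<open>{u, v}\<close>.\<close>
  have "weight_sum D_bullet T' = (\<Sum>A\<in>Pow (E - {{u, v}}). ?h A + ?h (insert {u, v} A))"
    unfolding T' weight_sum.simps
  proof (intro sum.cong refl prod_components_absorb)
    fix A e assume "A \<in> Pow (E - {{u, v}})" "e \<in> A"
    then show "e \<subseteq> V \<and> v \<notin> e \<and> card e = 2"
      using E' bf by auto
  qed (use bf \<open>u \<in> V\<close> \<open>v \<in> V\<close> \<open>u \<noteq> v\<close> v mu in auto)
  also have "\<dots> = (\<Sum>A\<in>Pow (E - {{u, v}}). ?h A) + (\<Sum>A\<in>insert {u, v} ` Pow (E - {{u, v}}). ?h A)"
    by (subst sum.reindex) (auto simp: sum.distrib inj_on_def insert_ident)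
  also have "\<dots> = (\<Sum>A\<in>Pow (E - {{u, v}}) \<union> insert {u, v} ` Pow (E - {{u, v}}). ?h A)"
    using finE by (intro sum.union_disjoint[symmetric]) auto
  also have "Pow (E - {{u, v}}) \<union> insert {u, v} ` Pow (E - {{u, v}}) = Pow E"
    using uv Pow_insert[of "{u, v}" "E - {{u, v}}"] by (simp add: insert_absorb)
  finally show "weight_sum D_bullet T' = weight_sum D_bullet T"
    by (simp add: T)
qed

text \<open>The case \<open>T' = T\<close> is the empty sequence of absorptions; it is excluded
  later, when an absorbable vertex is present.\<close>

lemma absorb_steps:
  assumes "absorb\<^sup>*\<^sup>* T T'" "bridge_forest T"
  shows "bridge_forest T' \<and> weight_sum D_bullet T' = weight_sum D_bullet T \<and>
    (T' = T \<or> graph_size T' < graph_size T)"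
  using assms
proof (induction rule: rtranclp_induct)
  case (step T1 T2)
  then show ?case
    using absorb_step[of T1 T2] by auto
qed simp

lemma core_exists:
  assumes "bridge_forest T"
  shows "\<exists>T'. is_core T T'"
  using assms
proof (induction T rule: measure_induct_rule[of graph_size])
  case (less T)
  show ?case
  proof (cases "\<exists>v. absorbable T v")
    case False
    then show ?thesis
      by (intro exI[of _ T]) (simp add: is_core_def)
  next
    case True
    then obtain v where v: "absorbable T v" ..
    obtain V E m where T: "T = (V, E, m)"
      by (cases T) auto
    note bf = less.prems[unfolded T]
    from v have "card {e \<in> E. v \<in> e} = 1"
      by (simp add: T degree_def)
    then obtain e where e: "e \<in> E" "v \<in> e"
      by (auto simp: card_1_singleton_iff)
    obtain x y where "e = {x, y}"
      using bridge_forest_edge[OF bf e(1)] by metis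
    with e(2) obtain u where "e = {u, v}"
      by (auto simp: insert_commute)
    moreover obtain w d where "m u = (w, d)"
      by (rule prod.exhaust)
    ultimately obtain T1 where T1: "absorb T T1"
      using v e(1) absorb.intros[of V E m v u w d] unfolding T by blast
    then obtain T' where "is_core T1 T'"
      using less.IH[of T1] absorb_step[OF T1 less.prems] by blast
    with T1 have "is_core T T'"
      by (auto simp: is_core_def intro: converse_rtranclp_into_rtranclp)
    then show ?thesis ..
  qed
qed

section \<open>The recursion\<close>

lemma M'_correct:
  assumes "M' r T p" "bridge_forest T"
  shows "weight_sum D_bullet T = zsubst D_bullet p"
  using assms
proof (induction rule: M'.induct)
  case (vertex v m)
  have "components {v} {} = {{v}}"
    by (simp add: components_eq)
  then show ?case
    by (simp)
next
  case (disconnected V E m p)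
  then show ?case
    by (simp add: weight_sum_components zsubst_prod bridge_forest_component
        del: weight_sum.simps bridge_forest.simps cong: prod.cong)
next
  case (absorb V E m T' p)
  then show ?case
    using absorb_steps by (metis is_core_def)
next
  case (expand V E m A' p)
  have "A' \<subseteq> E"
    using expand.hyps(4) by (auto simp: expansion_edges_def pendant_edges_def split: if_splits)
  then show ?case
    using expand.IH expand.hyps expand.prems
    by (auto simp: weight_sum_contract[OF expand.prems \<open>A' \<subseteq> E\<close>] zsubst_sum bridge_forest_contract
        simp del: weight_sum.simps bridge_forest.simps contract_delete.simps intro!: sum.cong)
qed

text \<open>Among all edges \<open>uv\<close> with a direction, one minimising the part behind \<open>v\<close> ends in a leaf.\<close>

lemma leaf_exists:
  assumes bf: "bridge_forest (V, E, m)" and "E \<noteq> {}"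
  shows "\<exists>v\<in>V. degree E v = 1"
proof -
  note edge = bridge_forest_edge[OF bf]
  \<comment> \<open>For a directed edge, the vertices on the side of its head after the edge is
    removed.\<close>
  let ?S = "\<lambda>p. cls (E - {{fst p, snd p}}) (snd p)" and ?P = "\<lambda>p. {fst p, snd p} \<in> E"
  obtain e0 where "e0 \<in> E"
    using \<open>E \<noteq> {}\<close> by blast
  moreover obtain u0 v0 where "e0 = {u0, v0}"
    using edge[OF \<open>e0 \<in> E\<close>] .
  ultimately have "?P (u0, v0)"
    by simp
  then obtain p where p: "?P p" "\<forall>q. ?P q \<longrightarrow> card (?S p) \<le> card (?S q)"
    using ex_has_least_nat[of ?P "(u0, v0)" "\<lambda>q. card (?S q)"] by blast
  obtain u v where "p = (u, v)"
    by (rule prod.exhaust)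
  then have uv: "{u, v} \<in> E"
    using p(1) by simp
  have min: "card (cls (E - {{u, v}}) v) \<le> card (cls (E - {{x, y}}) y)" if "{x, y} \<in> E" for x y
    using that p(2) \<open>p = (u, v)\<close> by auto
  have V: "u \<in> V" "v \<in> V"
    using bf uv by auto
  have "{e \<in> E. v \<in> e} = {{u, v}}"
  proof (rule ccontr)
    assume "{e \<in> E. v \<in> e} \<noteq> {{u, v}}"
    then obtain e where e: "e \<in> E" "v \<in> e" "e \<noteq> {u, v}"
      using uv by blast
    obtain x y where "e = {x, y}"
      using edge[OF e(1)] .
    with e(2) obtain w where w: "e = {v, w}"
      by (metis insertE insert_commute singletonD)
    have vw: "{v, w} \<in> E" "{v, w} \<noteq> {u, v}"
      using e w by auto
    have bridge: "v \<notin> cls (E - {{v, w}}) w"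
      using bf vw(1) sym_adj_rtrancl[of w v "E - {{v, w}}"] by (auto simp: cls_def all_bridges_def)
    \<comment> \<open>The part behind \<open>w\<close> sits inside the part behind \<open>v\<close>
      but misses \<open>v\<close>, because \<open>{v, w}\<close> is a bridge; this contradicts
      minimality.\<close>
    have "cls (E - {{v, w}}) w \<subseteq> cls (E - {{u, v}}) v - {v}"
    proof
      fix y assume "y \<in> cls (E - {{v, w}}) w"
      then have "(w, y) \<in> (adj (E - {{v, w}}))\<^sup>*"
        by (simp add: cls_def)
      then show "y \<in> cls (E - {{u, v}}) v - {v}"
      proof induction
        case base
        have "(v, w) \<in> adj (E - {{u, v}})"
          using vw by (simp add: adj_def)
        with bridge show ?case
          by (auto simp: cls_def)
      next
        case (step y y')
        have "y' \<in> cls (E - {{v, w}}) w"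
          using step.hyps by (auto simp: cls_def)
        with bridge have "y' \<noteq> v"
          by blast
        \<comment> \<open>Neither end of this step is \<open>v\<close>, so the edge used cannot be
          \<open>{u, v}\<close>.\<close>
        moreover have "(y, y') \<in> adj (E - {{u, v}})"
          using step.hyps step.IH \<open>y' \<noteq> v\<close> by (auto simp: adj_def doubleton_eq_iff)
        ultimately show ?case
          using step.IH by (auto simp: cls_def intro: rtrancl_into_rtrancl)
      qed
    qed
    then have "cls (E - {{v, w}}) w \<subset> cls (E - {{u, v}}) v"
      using cls_self[of v "E - {{u, v}}"] by blast
    moreover have "cls (E - {{u, v}}) v \<subseteq> V"
      using V bf by (intro cls_subset) auto
    ultimately have "card (cls (E - {{v, w}}) w) < card (cls (E - {{u, v}}) v)"
      using bf finite_subset by (intro psubset_card_mono) auto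
    with min[of v w] vw show False
      by simp
  qed
  then have "degree E v = 1"
    by (simp add: degree_def)
  with V show ?thesis by blast
qed

section \<open>Progress and existence of a value\<close>

lemma linear_order_max_exists:
  assumes "linear_order_on M r" "finite S" "S \<noteq> {}" "f ` S \<subseteq> M"
  shows "\<exists>x\<in>S. \<forall>y\<in>S. (f y, f x) \<in> r"
  using assms(2,3,4)
proof (induction rule: finite_ne_induct)
  case (singleton x)
  then show ?case
    using assms(1) by (auto simp: order_on_defs refl_on_def)
next
  case (insert x F)
  then obtain a where a: "a \<in> F" "\<forall>y\<in>F. (f y, f a) \<in> r"
    by auto
  have M: "f a \<in> M" "f x \<in> M"
    using insert.prems a by auto
  have "trans r" "refl_on M r" "total_on M r"
    using assms(1) by (auto simp: order_on_defs)
  then have "(f x, f a) \<in> r \<or> (f a, f x) \<in> r" "(f x, f x) \<in> r"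
    using M by (auto simp: refl_on_def total_on_def) metis
  then show ?case
    using a \<open>trans r\<close> by (metis insertE insertI1 insertI2 transD)
qed

text \<open>Nonemptiness of \<open>A'\<close> is what makes an expansion decrease the size. It is in
  question only for a star whose center has mark \<open>(1, 0)\<close>, where one pendant edge is
  kept.\<close>

lemma expansion_edges_exist:
  assumes bf: "bridge_forest (V, E, m)" and r: "linear_order_on marks r" and "E \<noteq> {}"
    and no_abs: "\<not> (\<exists>v. absorbable (V, E, m) v)"
  shows "\<exists>A'. expansion_edges r (V, E, m) A' \<and> A' \<subseteq> E \<and> A' \<noteq> {}"
proof -
  obtain l where l: "l \<in> V" "degree E l = 1"
    using leaf_exists[OF bf \<open>E \<noteq> {}\<close>] by blast
  have pendant: "\<exists>e\<in>pendant_edges E. v \<in> e" if "degree E v = 1" for v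
  proof -
    from that obtain e where "{e \<in> E. v \<in> e} = {e}"
      by (auto simp: degree_def card_1_singleton_iff)
    with that show ?thesis
      by (auto simp: pendant_edges_def)
  qed
  show ?thesis
  proof (cases "\<exists>c. is_star V E c \<and> m c = (1, 0)")
    case False
    then have "expansion_edges r (V, E, m) (pendant_edges E)"
      by (auto simp: expansion_edges_def)
    with pendant[OF l(2)] show ?thesis
      by (intro exI[of _ "pendant_edges E"]) (auto simp: pendant_edges_def)
  next
    case True
    then obtain c where c: "c \<in> V" "E = (\<lambda>v. {c, v}) ` (V - {c})" "m c = (1, 0)"
      by (auto simp: is_star_def)
    let ?L = "{v \<in> V. degree E v = 1}"
    have "\<exists>x\<in>?L. \<forall>y\<in>?L. (m y, m x) \<in> r"
      using bf l by (intro linear_order_max_exists[OF r]) auto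
    then obtain l' where l': "largest_leaf r (V, E, m) l'"
      by (auto simp: largest_leaf_def)
    then obtain e where e: "e \<in> pendant_edges E" "l' \<in> e"
      using pendant by (auto simp: largest_leaf_def)
    have "E \<subseteq> pendant_edges E"
    proof
      fix f assume "f \<in> E"
      then obtain v where v: "f = {c, v}" "v \<in> V - {c}"
        using c(2) by auto
      have "{e \<in> E. v \<in> e} = {{c, v}}"
        using v c(2) by auto
      then have "degree E v = 1"
        by (simp add: degree_def)
      with v \<open>f \<in> E\<close> show "f \<in> pendant_edges E"
        by (auto simp: pendant_edges_def)
    qed
    \<comment> \<open>In a star with a single edge the center is itself a leaf, and with mark
      \<open>(1, 0)\<close> it would be absorbable.\<close>
    moreover have "E \<noteq> {e}"
    proof
      assume E: "E = {e}"
      then have "c \<in> e"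
        using c(2) by auto
      then have "{f \<in> E. c \<in> f} = {e}"
        using E by auto
      then have "degree E c = 1"
        by (simp add: degree_def)
      with no_abs c show False
        by auto
    qed
    ultimately have "pendant_edges E - {e} \<noteq> {}"
      using \<open>E \<noteq> {}\<close> by blast
    moreover have "expansion_edges r (V, E, m) (pendant_edges E - {e})"
      using True l' e by (auto simp: expansion_edges_def)
    ultimately show ?thesis
      by (intro exI[of _ "pendant_edges E - {e}"]) (auto simp: pendant_edges_def)
  qed
qed

lemma M'_exists:
  assumes r: "linear_order_on marks r" and "bridge_forest T"
  shows "\<exists>p. M' r T p"
  using assms(2)
proof (induction T rule: measure_induct_rule[of graph_size])
  case (less T)
  obtain V E m where T: "T = (V, E, m)"
    by (cases T) auto
  note bf = less.prems[unfolded T]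
  note E = bridge_forest_edges_subset[OF bf]
  have fin: "finite V" "finite E"
    using bf finite_subset[OF E] by auto
  have "finite (components V E)" "components V E \<noteq> {}"
    using bf by (auto simp: components_eq[OF E])
  then have "card (components V E) > 0"
    by (simp add: card_gt_0_iff)
  then consider "card (components V E) > 1" | "card (components V E) = 1" "\<exists>v. absorbable (V, E, m) v"
    | "card (components V E) = 1" "E = {}"
    | "card (components V E) = 1" "E \<noteq> {}" "\<not> (\<exists>v. absorbable (V, E, m) v)"
    by (metis One_nat_def Suc_lessI)
  then show ?case
  proof cases
    case 1
    have "\<exists>p. M' r (C, {e \<in> E. e \<subseteq> C}, m) p" if C: "C \<in> components V E" for C
    proof (rule less.IH[OF _ bridge_forest_component[OF bf C]])
      have "C \<noteq> V"
      proof
        assume "C = V"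
        have "C' = C" if C': "C' \<in> components V E" for C'
        proof -
          have "C' \<subseteq> V" "C' \<noteq> {}"
            using components_memD[OF E C'] by auto
          then show ?thesis
            using disjointD[OF components_partition(2)[OF bf] C' C] \<open>C = V\<close> by blast
        qed
        then have "components V E = {C}"
          using C by blast
        with 1 show False by simp
      qed
      then have "card C < card V"
        using components_memD(1)[OF E C] fin by (intro psubset_card_mono) auto
      moreover have "card {e \<in> E. e \<subseteq> C} \<le> card E"
        using fin by (intro card_mono) auto
      ultimately show "graph_size (C, {e \<in> E. e \<subseteq> C}, m) < graph_size T"
        by (simp add: T)
    qed
    then obtain p where "\<forall>C\<in>components V E. M' r (C, {e \<in> E. e \<subseteq> C}, m) (p C)"
      by metis
    with 1 show ?thesis
      unfolding T by (blast intro: M'.disconnected)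
  next
    case 2
    obtain T' where T': "is_core (V, E, m) T'"
      using core_exists[OF bf] by blast
    \<comment> \<open>A core has no absorbable vertex, whereas \<open>T\<close> has one, so at least
      one absorption took place.\<close>
    have "T' \<noteq> T"
      using T' 2(2) by (auto simp: T is_core_def)
    then have "bridge_forest T'" "graph_size T' < graph_size T"
      using T' absorb_steps[of T T'] less.prems by (auto simp: T is_core_def)
    then obtain p where "M' r T' p"
      using less.IH by blast
    with 2 T' show ?thesis
      unfolding T by (blast intro: M'.absorb)
  next
    case 3
    then have "components V E = (\<lambda>x. {x}) ` V"
      by (simp add: components_eq)
    then have "card V = 1"
      using 3 by (simp add: card_image)
    then obtain v where "V = {v}"
      by (auto simp: card_1_singleton_iff)
    with 3 show ?thesis
      unfolding T by (blast intro: M'.vertex)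
  next
    case 4
    obtain A' where A': "expansion_edges r (V, E, m) A'" "A' \<subseteq> E" "A' \<noteq> {}"
      using expansion_edges_exist[OF bf r 4(2,3)] by blast
    have "\<exists>p. M' r (contract_delete (V, E, m) A (A' - A)) p" if A: "A \<in> Pow A'" for A
    proof (rule less.IH)
      show "bridge_forest (contract_delete (V, E, m) A (A' - A))"
        using A A'(2) by (intro bridge_forest_contract[OF bf]) auto
      \<comment> \<open>All of \<open>A'\<close> leaves the edge set, whether contracted or deleted,
        and taking images cannot increase the count.\<close>
      have "card ((`) (rep V A) ` (E - A - (A' - A))) \<le> card (E - A - (A' - A))"
        using fin by (intro card_image_le) auto
      also have "\<dots> < card E"
        using A A' fin by (intro psubset_card_mono) auto
      finally show "graph_size (contract_delete (V, E, m) A (A' - A)) < graph_size T"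
        using card_image_le[OF fin(1), of "rep V A"] by (simp add: T)
    qed
    then obtain p where "\<forall>A\<in>Pow A'. M' r (contract_delete (V, E, m) A (A' - A)) (p A)"
      by metis
    with 4 A' show ?thesis
      unfolding T by (blast intro: M'.expand)
  qed
qed

text \<open>The existence part keeps the universal part from holding vacuously; the latter covers
  every order of absorption and every way of breaking ties.\<close>

theorem theorem6p5:
  fixes r :: "mark rel" and T :: "'a mgraph"
  assumes "linear_order_on marks r"
    and "marked_forest T"
  shows "(\<exists>p. M' r T p) \<and> (\<forall>p. M' r T p \<longrightarrow> D_poly T = zsubst D_bullet p)"
  unfolding D_poly_eq_weight_sum
  using M'_exists[OF assms(1)] M'_correct marked_forest_imp_bridge_forest[OF assms(2)] by blast

end
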